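(* Let $d\ge 1$ and let $\Delta$ be a $d$-dimensional normal simplicial pseudomanifold with banner number $b_\Delta$. Then the graph $\mathcal{G}(\Delta)$ is $(2d-b_{\Delta})$-connected.
   Context: All simplicial complexes are finite; the empty set is a face of every complex. Let $\Delta$ be a pure $d$-dimensional simplicial complex with vertex set $V$ (pure: all maximal faces, called facets, have dimension $d$, i.e. $d+1$ vertices). Graph: $\mathcal{G}(\Delta)$ is the simple graph whose nodes are the vertices of $\Delta$ and whose edges are the one-dimensional faces of $\Delta$. Link: for a face $\tau\in\Delta$, $\operatorname{link}_\Delta(\tau)=\{\sigma\in\Delta : \sigma\cap\tau=\emptyset,\ \sigma\cup\tau\in\Delta\}$; in particular $\operatorname{link}_\Delta(\emptyset)=\Delta$. Pseudomanifold: $\Delta$ is a pseudomanifold if (i) every $(d-1)$-dimensional face is contained in exactly two facets, and (ii) $\Delta$ is strongly connected, meaning that the facet graph (vertices are the facets, edges are the pairs of facets sharing a $(d-1)$-dimensional face) is connected. A pseudomanifold is normal if all links $\operatorname{link}_\Delta(\tau)$ of dimension at least one are connected. Banner: a clique is a subset $T\subseteq V$ such that $\{u,v\}\in\Delta$ for all $u,v\in T$; it is a $j$-clique if $|T|=j$. A clique $T$ is spanning if $T\in\Delta$, and critical if $T\setminus\{v\}\in\Delta$ for some $v\in T$. A pure $d$-dimensional complex $\Delta$ is banner if every critical $(d+1)$-clique is spanning and $\Delta$ does not contain the boundary complex of a $(d+1)$-simplex as a subcomplex. Banner number: with $C_3$ denoting the boundary complex of a triangle (the cycle graph on 3 vertices),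 $$b_{\Delta}=\min\{j\ge 0 : \operatorname{link}_\Delta(\sigma)\text{ is banner or } C_3 \text{ for all } \sigma\in\Delta \text{ such that } |\sigma|=j\},$$ where each link is a pure complex and "banner" is understood with respect to its own dimension. Connectivity: a graph $G$ is $k$-connected if it has more than $k$ vertices and $G\setminus S$ is connected for every set $S$ of vertices with $|S|<k$, where $G\setminus S$ is obtained by deleting the vertices of $S$ and all incident edges. *)

theory Defs
  imports "Graph_Theory.Graph_Theory"
begin

section \<open>Graphs\<close>

text \<open>
  A simple graph is a symmetric loop-free \<^typ>\<open>'a pair_pre_digraph\<close>. For \<open>S\<close> with
  \<open>|S| < k\<close> the remaining graph is never empty, so it does not matter that
  \<^const>\<open>connected\<close> is false for the empty graph.
\<close>

definition k_connected :: "nat \<Rightarrow> 'a pair_pre_digraph \<Rightarrow> bool" where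
  "k_connected k G \<longleftrightarrow>
     k < card (pverts G) \<and>
     (\<forall>S \<subseteq> pverts G. card S < k \<longrightarrow> connected (with_proj G \<restriction> (pverts G - S)))"

section \<open>Finite abstract simplicial complexes\<close>

definition abstract_complex :: "'a set set \<Rightarrow> bool" where
  "abstract_complex \<Delta> \<longleftrightarrow>
     finite \<Delta> \<and> (\<forall>F\<in>\<Delta>. finite F) \<and> {} \<in> \<Delta> \<and> (\<forall>F\<in>\<Delta>. \<forall>G\<subseteq>F. G \<in> \<Delta>)"

definition complex_verts :: "'a set set \<Rightarrow> 'a set" where
  "complex_verts \<Delta> = {v. {v} \<in> \<Delta>}"

text \<open>Dimensions are integers because the empty face has dimension \<open>-1\<close>.\<close>

definition face_dim :: "'a set \<Rightarrow> int" where
  "face_dim F = int (card F) - 1"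

definition complex_dim :: "'a set set \<Rightarrow> int" where
  "complex_dim \<Delta> = Max (face_dim ` \<Delta>)"

definition facets :: "'a set set \<Rightarrow> 'a set set" where
  "facets \<Delta> = {F \<in> \<Delta>. \<forall>G\<in>\<Delta>. F \<subseteq> G \<longrightarrow> G = F}"

definition pure_complex :: "'a set set \<Rightarrow> bool" where
  "pure_complex \<Delta> \<longleftrightarrow> abstract_complex \<Delta> \<and> (\<forall>F\<in>facets \<Delta>. face_dim F = complex_dim \<Delta>)"

definition complex_graph :: "'a set set \<Rightarrow> 'a pair_pre_digraph" where
  "complex_graph \<Delta> =
     \<lparr> pverts = complex_verts \<Delta>, parcs = {(u, v). u \<noteq> v \<and> {u, v} \<in> \<Delta>} \<rparr>"

definition link :: "'a set set \<Rightarrow> 'a set \<Rightarrow> 'a set set" where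
  "link \<Delta> \<tau> = {\<sigma> \<in> \<Delta>. \<sigma> \<inter> \<tau> = {} \<and> \<sigma> \<union> \<tau> \<in> \<Delta>}"

text \<open>The boundary complex of the simplex with vertex set \<open>S\<close>, of dimension \<open>|S| - 1\<close>.\<close>

definition simplex_boundary :: "'a set \<Rightarrow> 'a set set" where
  "simplex_boundary S = {F. F \<subset> S}"

section \<open>Normal pseudomanifolds\<close>

definition facet_graph :: "'a set set \<Rightarrow> 'a set pair_pre_digraph" where
  "facet_graph \<Delta> =
     \<lparr> pverts = facets \<Delta>,
       parcs = {(F, G). F \<in> facets \<Delta> \<and> G \<in> facets \<Delta> \<and> F \<noteq> G \<and>
                  (\<exists>R\<in>\<Delta>. face_dim R = complex_dim \<Delta> - 1 \<and> R \<subseteq> F \<and> R \<subseteq> G)} \<rparr>"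

definition pseudomanifold :: "'a set set \<Rightarrow> bool" where
  "pseudomanifold \<Delta> \<longleftrightarrow>
     pure_complex \<Delta> \<and>
     (\<forall>R\<in>\<Delta>. face_dim R = complex_dim \<Delta> - 1 \<longrightarrow> card {F \<in> facets \<Delta>. R \<subseteq> F} = 2) \<and>
     connected (with_proj (facet_graph \<Delta>))"

text \<open>A complex is connected iff its graph (1-skeleton) is.\<close>

definition normal_pseudomanifold :: "'a set set \<Rightarrow> bool" where
  "normal_pseudomanifold \<Delta> \<longleftrightarrow>
     pseudomanifold \<Delta> \<and>
     (\<forall>\<tau>\<in>\<Delta>. complex_dim (link \<Delta> \<tau>) \<ge> 1 \<longrightarrow>
        connected (with_proj (complex_graph (link \<Delta> \<tau>))))"

section \<open>Banner complexes and the banner number\<close>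

text \<open>For \<open>u = v\<close> the condition says \<open>{u} \<in> \<Delta>\<close>.\<close>

definition complex_clique :: "'a set set \<Rightarrow> 'a set \<Rightarrow> bool" where
  "complex_clique \<Delta> T \<longleftrightarrow> T \<subseteq> complex_verts \<Delta> \<and> (\<forall>u\<in>T. \<forall>v\<in>T. {u, v} \<in> \<Delta>)"

definition critical_clique :: "'a set set \<Rightarrow> 'a set \<Rightarrow> bool" where
  "critical_clique \<Delta> T \<longleftrightarrow> complex_clique \<Delta> T \<and> (\<exists>v\<in>T. T - {v} \<in> \<Delta>)"

definition spanning_clique :: "'a set set \<Rightarrow> 'a set \<Rightarrow> bool" where
  "spanning_clique \<Delta> T \<longleftrightarrow> complex_clique \<Delta> T \<and> T \<in> \<Delta>"

text \<open>
  With \<open>d = complex_dim \<Delta>\<close>, a \<open>(d+1)\<close>-clique has \<open>d + 1\<close> elements, while a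
  \<open>(d+1)\<close>-simplex has dimension \<open>d + 1\<close>.
\<close>

definition banner :: "'a set set \<Rightarrow> bool" where
  "banner \<Delta> \<longleftrightarrow>
     pure_complex \<Delta> \<and>
     (\<forall>T. critical_clique \<Delta> T \<and> int (card T) = complex_dim \<Delta> + 1 \<longrightarrow> spanning_clique \<Delta> T) \<and>
     \<not> (\<exists>S. finite S \<and> face_dim S = complex_dim \<Delta> + 1 \<and> simplex_boundary S \<subseteq> \<Delta>)"

definition is_C3 :: "'a set set \<Rightarrow> bool" where
  "is_C3 \<Delta> \<longleftrightarrow> (\<exists>S. card S = 3 \<and> \<Delta> = simplex_boundary S)"

text \<open>
  The minimum exists for every finite \<open>\<Delta>\<close>: the condition holds vacuously once \<open>j\<close>
  exceeds the size of every face. For normal pseudomanifolds of dimension \<open>d \<ge> 1\<close> it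
  is at most \<open>d - 1\<close>, since links of faces with \<open>d - 1\<close> vertices are cycles; in
  particular the subtraction \<open>2 * d - banner_number \<Delta>\<close> is never truncated.
\<close>

definition banner_number :: "'a set set \<Rightarrow> nat" where
  "banner_number \<Delta> =
     (LEAST j. \<forall>\<sigma>\<in>\<Delta>. card \<sigma> = j \<longrightarrow> banner (link \<Delta> \<sigma>) \<or> is_C3 (link \<Delta> \<sigma>))"

end

theory Submission
  imports Defs
begin

text \<open>
  A path through a deleted vertex \<open>w\<close> can be rerouted through the link of \<open>w\<close>, so \<open>G - S\<close> is
  connected as soon as \<open>G - (S - {w})\<close> and \<open>link w - S\<close> are, for some \<open>w \<in> S\<close>. Vertex links
  have dimension \<open>d - 1\<close> and banner number at most \<open>b - 1\<close>, and links in banner complexes are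
  banner. By induction on \<open>d\<close> this settles \<open>b > 0\<close>; for \<open>b = 0\<close> it fails only if \<open>|S| = 2d - 1\<close>
  and every vertex of \<open>S\<close> is adjacent to all the others. But a clique never separates a banner
  complex: rerouting repeatedly descends to one-dimensional links of faces inside \<open>S\<close>, which are
  2-connected graphs, and there any two vertices of \<open>S\<close> are adjacent by the banner property.
\<close>

section \<open>Complexes and links\<close>

text \<open>The loops \<open>(u, u)\<close> at vertices are harmless, since only the reflexive
  transitive closure is used.\<close>

definition edges_off :: "'a set set \<Rightarrow> 'a set \<Rightarrow> ('a \<times> 'a) set" where
  "edges_off \<Delta> S = {(u, v). u \<notin> S \<and> v \<notin> S \<and> {u, v} \<in> \<Delta>}"

text \<open>\<open>S\<close> may contain points that are not vertices, and nothing is required when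
  no vertex remains. So the same \<open>S\<close> can be deleted from a complex and from its
  links.\<close>

definition connected_off :: "'a set set \<Rightarrow> 'a set \<Rightarrow> bool" where
  "connected_off \<Delta> S \<longleftrightarrow>
     (\<forall>u v. {u} \<in> \<Delta> \<longrightarrow> {v} \<in> \<Delta> \<longrightarrow> u \<notin> S \<longrightarrow> v \<notin> S \<longrightarrow> (u, v) \<in> (edges_off \<Delta> S)\<^sup>*)"

text \<open>Normal pseudomanifolds without strong connectivity, a class closed under links;
  \<open>n = d + 1\<close> is the size of the facets.\<close>

definition npm :: "nat \<Rightarrow> 'a set set \<Rightarrow> bool" where
  "npm n \<Delta> \<longleftrightarrow> abstract_complex \<Delta> \<and>
     (\<forall>F\<in>\<Delta>. card F \<le> n \<and> (\<exists>G\<in>\<Delta>. F \<subseteq> G \<and> card G = n)) \<and>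
     (\<forall>R\<in>\<Delta>. Suc (card R) = n \<longrightarrow> card {F \<in> \<Delta>. R \<subseteq> F \<and> card F = n} = 2) \<and>
     (\<forall>\<tau>\<in>\<Delta>. card \<tau> + 2 \<le> n \<longrightarrow> connected_off (link \<Delta> \<tau>) {})"

section \<open>Elementary facts on complexes, links and \<open>npm\<close>\<close>

lemma abstract_complexD:
  assumes "abstract_complex \<Delta>"
  shows "finite \<Delta>" "{} \<in> \<Delta>" "F \<in> \<Delta> \<Longrightarrow> finite F" "F \<in> \<Delta> \<Longrightarrow> G \<subseteq> F \<Longrightarrow> G \<in> \<Delta>"
  using assms unfolding abstract_complex_def by blast+

lemma npmD:
  assumes "npm n \<Delta>"
  shows "abstract_complex \<Delta>"
    "F \<in> \<Delta> \<Longrightarrow> card F \<le> n"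
    "F \<in> \<Delta> \<Longrightarrow> \<exists>G\<in>\<Delta>. F \<subseteq> G \<and> card G = n"
    "R \<in> \<Delta> \<Longrightarrow> Suc (card R) = n \<Longrightarrow> card {F \<in> \<Delta>. R \<subseteq> F \<and> card F = n} = 2"
    "\<tau> \<in> \<Delta> \<Longrightarrow> card \<tau> + 2 \<le> n \<Longrightarrow> connected_off (link \<Delta> \<tau>) {}"
  using assms unfolding npm_def by blast+

lemma finite_complex_verts:
  assumes "abstract_complex \<Delta>"
  shows "finite (complex_verts \<Delta>)"
proof -
  have "(\<lambda>v. {v}) ` complex_verts \<Delta> \<subseteq> \<Delta>"
    by (auto simp: complex_verts_def)
  then have "finite ((\<lambda>v. {v}) ` complex_verts \<Delta>)"
    using abstract_complexD(1)[OF assms] finite_subset by blast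
  then show ?thesis by (rule finite_imageD) auto
qed

lemma edge_verts:
  assumes "abstract_complex \<Delta>" "{u, v} \<in> \<Delta>"
  shows "{u} \<in> \<Delta>" "{v} \<in> \<Delta>"
  using abstract_complexD(4)[OF assms] by auto

lemma link_empty: "link \<Delta> {} = \<Delta>"
  by (auto simp: link_def)

lemma link_subset: "link \<Delta> \<tau> \<subseteq> \<Delta>"
  by (auto simp: link_def)

lemma abstract_complex_link:
  assumes "abstract_complex \<Delta>" "\<tau> \<in> \<Delta>"
  shows "abstract_complex (link \<Delta> \<tau>)"
  unfolding abstract_complex_def
proof (intro conjI ballI allI impI)
  show "finite (link \<Delta> \<tau>)"
    using abstract_complexD(1)[OF assms(1)] link_subset finite_subset by metis
  show "{} \<in> link \<Delta> \<tau>"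
    using assms abstract_complexD(2)[OF assms(1)] by (simp add: link_def)
next
  fix F G assume F: "F \<in> link \<Delta> \<tau>" and G: "G \<subseteq> F"
  have "G \<union> \<tau> \<subseteq> F \<union> \<tau>" using G by blast
  with F G show "G \<in> link \<Delta> \<tau>"
    using abstract_complexD(4)[OF assms(1)] unfolding link_def by blast
qed (use abstract_complexD(3)[OF assms(1)] in \<open>auto simp: link_def\<close>)

text \<open>The harder inclusion is closure under subsets of the one face
  \<open>\<rho> \<union> (\<tau> \<union> \<sigma>)\<close>. Repeated passage to vertex links thus
  stays among the links of the original complex.\<close>

lemma link_link:
  assumes "abstract_complex \<Delta>" "\<sigma> \<in> link \<Delta> \<tau>"
  shows "link (link \<Delta> \<tau>) \<sigma> = link \<Delta> (\<tau> \<union> \<sigma>)"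
proof (intro equalityI subsetI)
  fix \<rho> assume "\<rho> \<in> link (link \<Delta> \<tau>) \<sigma>"
  then show "\<rho> \<in> link \<Delta> (\<tau> \<union> \<sigma>)"
    by (auto simp: link_def Un_ac)
next
  fix \<rho> assume r: "\<rho> \<in> link \<Delta> (\<tau> \<union> \<sigma>)"
  then have all: "\<rho> \<union> (\<tau> \<union> \<sigma>) \<in> \<Delta>" by (simp add: link_def)
  have "\<rho> \<union> \<tau> \<in> \<Delta>" "\<rho> \<union> \<sigma> \<in> \<Delta>" "\<rho> \<union> \<sigma> \<union> \<tau> \<in> \<Delta>"
    by (rule abstract_complexD(4)[OF assms(1) all]; blast)+
  with r assms(2) show "\<rho> \<in> link (link \<Delta> \<tau>) \<sigma>"
    by (auto simp: link_def)
qed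

lemma link_singleton_iff:
  assumes "abstract_complex \<Delta>"
  shows "\<sigma> \<in> link \<Delta> {v} \<longleftrightarrow> v \<notin> \<sigma> \<and> insert v \<sigma> \<in> \<Delta>"
  using abstract_complexD(4)[OF assms, of "insert v \<sigma>" \<sigma>] by (auto simp: link_def)

lemma card_Un_link:
  assumes "abstract_complex \<Delta>" "\<tau> \<in> \<Delta>" "\<sigma> \<in> link \<Delta> \<tau>"
  shows "card (\<tau> \<union> \<sigma>) = card \<tau> + card \<sigma>"
  using assms abstract_complexD(3)[OF assms(1)]
  by (intro card_Un_disjoint) (auto simp: link_def)

text \<open>Joining with \<open>\<tau>\<close> identifies the faces of the link with the faces of
  \<open>\<Delta>\<close> containing \<open>\<tau>\<close>. This is what makes induction on the
  dimension possible.\<close>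

lemma npm_link:
  assumes N: "npm n \<Delta>" and t: "\<tau> \<in> \<Delta>"
  shows "npm (n - card \<tau>) (link \<Delta> \<tau>)"
proof -
  note ac = npmD(1)[OF N]
  note fin = abstract_complexD(3)[OF ac]
  have tn: "card \<tau> \<le> n" using npmD(2)[OF N t] .
  show ?thesis
    unfolding npm_def
  proof (intro conjI ballI impI)
    show "abstract_complex (link \<Delta> \<tau>)" by (rule abstract_complex_link[OF ac t])
  next
    fix F assume F: "F \<in> link \<Delta> \<tau>"
    then have FD: "\<tau> \<union> F \<in> \<Delta>" by (simp add: link_def Un_commute)
    show "card F \<le> n - card \<tau>"
      using npmD(2)[OF N FD] card_Un_link[OF ac t F] by simp
    obtain G where G: "G \<in> \<Delta>" "\<tau> \<union> F \<subseteq> G" "card G = n"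
      using npmD(3)[OF N FD] by blast
    have "G - \<tau> \<in> \<Delta>" using abstract_complexD(4)[OF ac G(1)] by blast
    moreover have "G - \<tau> \<union> \<tau> = G" using G(2) by blast
    ultimately have "G - \<tau> \<in> link \<Delta> \<tau>" using G(1) by (auto simp: link_def)
    moreover have "F \<subseteq> G - \<tau>" using G(2) F by (auto simp: link_def)
    moreover have "card (G - \<tau>) = n - card \<tau>"
      using G fin[OF t] by (simp add: card_Diff_subset)
    ultimately show "\<exists>G\<in>link \<Delta> \<tau>. F \<subseteq> G \<and> card G = n - card \<tau>" by blast
  next
    fix R assume R: "R \<in> link \<Delta> \<tau>" and c: "Suc (card R) = n - card \<tau>"
    have RD: "\<tau> \<union> R \<in> \<Delta>" using R by (simp add: link_def Un_commute)
    have "Suc (card (\<tau> \<union> R)) = n" using c card_Un_link[OF ac t R] by simp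
    from npmD(4)[OF N RD this]
    have two: "card {F \<in> \<Delta>. \<tau> \<union> R \<subseteq> F \<and> card F = n} = 2" .
    \<comment> \<open>Facets of the link around \<open>R\<close> correspond to facets of
      \<open>\<Delta>\<close> around \<open>\<tau> \<union> R\<close>.\<close>
    have "bij_betw (\<lambda>F. \<tau> \<union> F) {F \<in> link \<Delta> \<tau>. R \<subseteq> F \<and> card F = n - card \<tau>}
            {F \<in> \<Delta>. \<tau> \<union> R \<subseteq> F \<and> card F = n}"
    proof (rule bij_betw_byWitness[where f' = "\<lambda>F. F - \<tau>"])
      show "(\<lambda>F. \<tau> \<union> F) ` {F \<in> link \<Delta> \<tau>. R \<subseteq> F \<and> card F = n - card \<tau>}
              \<subseteq> {F \<in> \<Delta>. \<tau> \<union> R \<subseteq> F \<and> card F = n}"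
        using card_Un_link[OF ac t] tn by (auto simp: link_def Un_commute)
      show "(\<lambda>F. F - \<tau>) ` {F \<in> \<Delta>. \<tau> \<union> R \<subseteq> F \<and> card F = n}
              \<subseteq> {F \<in> link \<Delta> \<tau>. R \<subseteq> F \<and> card F = n - card \<tau>}"
      proof clarify
        fix F assume F: "F \<in> \<Delta>" "\<tau> \<union> R \<subseteq> F" "n = card F"
        have "F - \<tau> \<in> \<Delta>" using abstract_complexD(4)[OF ac F(1)] by blast
        moreover have "F - \<tau> \<union> \<tau> = F" using F(2) by blast
        ultimately have "F - \<tau> \<in> link \<Delta> \<tau>" using F(1) by (auto simp: link_def)
        moreover have "R \<subseteq> F - \<tau>" using F(2) R by (auto simp: link_def)
        ultimately show "F - \<tau> \<in> link \<Delta> \<tau> \<and> R \<subseteq> F - \<tau> \<and> card (F - \<tau>) = card F - card \<tau>"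
          using F(2) fin[OF t] by (simp add: card_Diff_subset)
      qed
    qed (auto simp: link_def)
    then show "card {F \<in> link \<Delta> \<tau>. R \<subseteq> F \<and> card F = n - card \<tau>} = 2"
      using two by (simp add: bij_betw_same_card)
  next
    fix \<sigma> assume s: "\<sigma> \<in> link \<Delta> \<tau>" and c: "card \<sigma> + 2 \<le> n - card \<tau>"
    have sD: "\<tau> \<union> \<sigma> \<in> \<Delta>" using s by (simp add: link_def Un_commute)
    have "card (\<tau> \<union> \<sigma>) + 2 \<le> n" using c card_Un_link[OF ac t s] tn by simp
    then show "connected_off (link (link \<Delta> \<tau>) \<sigma>) {}"
      using npmD(5)[OF N sD] link_link[OF ac s] by simp
  qed
qed

lemma npm_complex_dim:
  assumes N: "npm n \<Delta>"
  shows "complex_dim \<Delta> = int n - 1"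
  unfolding complex_dim_def
proof (rule Max_eqI)
  note ac = npmD(1)[OF N]
  show "finite (face_dim ` \<Delta>)" using abstract_complexD(1)[OF ac] by simp
  show "y \<le> int n - 1" if "y \<in> face_dim ` \<Delta>" for y
    using that npmD(2)[OF N] by (force simp: face_dim_def)
  obtain G where "G \<in> \<Delta>" "card G = n"
    using npmD(3)[OF N abstract_complexD(2)[OF ac]] by blast
  then show "int n - 1 \<in> face_dim ` \<Delta>" by (force simp: face_dim_def)
qed

lemma npm_pure:
  assumes N: "npm n \<Delta>"
  shows "pure_complex \<Delta>"
  unfolding pure_complex_def
proof (intro conjI ballI)
  show "abstract_complex \<Delta>" by (rule npmD(1)[OF N])
  fix F assume F: "F \<in> facets \<Delta>"
  then obtain G where "G \<in> \<Delta>" "F \<subseteq> G" "card G = n"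
    using npmD(3)[OF N, of F] by (auto simp: facets_def)
  with F have "card F = n" by (auto simp: facets_def)
  then show "face_dim F = complex_dim \<Delta>"
    by (simp add: face_dim_def npm_complex_dim[OF N])
qed

section \<open>Connectivity after deleting vertices\<close>

text \<open>Used to discard from \<open>S\<close> the points that are not vertices of the complex or
  link at hand.\<close>

lemma connected_off_cong:
  assumes "abstract_complex \<Delta>" "S \<inter> complex_verts \<Delta> = S' \<inter> complex_verts \<Delta>"
  shows "connected_off \<Delta> S \<longleftrightarrow> connected_off \<Delta> S'"
proof -
  have eq: "v \<in> S \<longleftrightarrow> v \<in> S'" if "{v} \<in> \<Delta>" for v
    using that assms(2) unfolding complex_verts_def by blast
  have "edges_off \<Delta> S = edges_off \<Delta> S'"
    using eq edge_verts[OF assms(1)] unfolding edges_off_def by blast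
  then show ?thesis using eq unfolding connected_off_def by metis
qed

text \<open>A walk avoiding \<open>S - {w}\<close> can meet \<open>S\<close> only at
  \<open>w\<close>; each visit is replaced by a detour from the neighbour before it to the neighbour
  after it.\<close>

lemma connected_off_reroute:
  assumes c: "connected_off \<Delta> (S - {w})"
    and nb: "\<And>u v. {u, w} \<in> \<Delta> \<Longrightarrow> {v, w} \<in> \<Delta> \<Longrightarrow> u \<notin> S \<Longrightarrow> v \<notin> S \<Longrightarrow>
               (u, v) \<in> (edges_off \<Delta> S)\<^sup>*"
  shows "connected_off \<Delta> S"
  unfolding connected_off_def
proof (intro allI impI)
  fix u v assume uv: "{u} \<in> \<Delta>" "{v} \<in> \<Delta>" "u \<notin> S" "v \<notin> S"
  let ?E = "edges_off \<Delta> S"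
  have "(u, v) \<in> (edges_off \<Delta> (S - {w}))\<^sup>*"
    using c uv unfolding connected_off_def by blast
  \<comment> \<open>The walk may be standing at \<open>w\<close> with its next vertex still unknown,
    so the invariant then promises every neighbour of \<open>w\<close> off \<open>S\<close>.\<close>
  then have "(v \<notin> S \<longrightarrow> (u, v) \<in> ?E\<^sup>*) \<and>
    (v = w \<longrightarrow> (\<forall>x. {x, w} \<in> \<Delta> \<longrightarrow> x \<notin> S \<longrightarrow> (u, x) \<in> ?E\<^sup>*))"
  proof (induction rule: rtrancl_induct)
    case base
    \<comment> \<open>\<open>w\<close> is not assumed to lie in \<open>S\<close>, so the walk may
      start there.\<close>
    have "(u, x) \<in> ?E\<^sup>*" if "u = w" "{x, w} \<in> \<Delta>" "x \<notin> S" for x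
      using that uv by (intro r_into_rtrancl) (auto simp: edges_off_def insert_commute)
    then show ?case by simp
  next
    case (step y z)
    from step(2) have yz: "{y, z} \<in> \<Delta>" "y \<notin> S \<or> y = w" "z \<notin> S \<or> z = w"
      by (auto simp: edges_off_def)
    have *: "(u, z) \<in> ?E\<^sup>*" if z: "z \<notin> S"
    proof (cases "y \<in> S")
      case False
      then have "(u, y) \<in> ?E\<^sup>*" "(y, z) \<in> ?E"
        using step(3) yz z by (auto simp: edges_off_def)
      then show ?thesis by simp
    next
      case True
      then have "y = w" using yz by simp
      then show ?thesis using step(3) yz(1) z by (auto simp: insert_commute)
    qed
    have "(u, x) \<in> ?E\<^sup>*" if z: "z = w" and x: "{x, w} \<in> \<Delta>" "x \<notin> S" for x
    proof (cases "y = w \<or> y \<in> S")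
      case True
      then show ?thesis using step(3) yz x by blast
    next
      case False
      then have "(u, y) \<in> ?E\<^sup>*" using step(3) by simp
      moreover have "(y, x) \<in> ?E\<^sup>*" using nb[of y x] False yz z x by simp
      ultimately show ?thesis by simp
    qed
    with * show ?case by simp
  qed
  with uv show "(u, v) \<in> ?E\<^sup>*" by simp
qed

text \<open>The neighbours of \<open>w\<close> are the vertices of its link, so the detours can be
  taken inside the link.\<close>

lemma connected_off_reroute_link:
  assumes ac: "abstract_complex \<Delta>" and w: "w \<in> S"
    and c: "connected_off \<Delta> (S - {w})"
    and l: "connected_off (link \<Delta> {w}) S"
  shows "connected_off \<Delta> S"
proof (rule connected_off_reroute[OF c])
  fix u v assume uv: "{u, w} \<in> \<Delta>" "{v, w} \<in> \<Delta>" "u \<notin> S" "v \<notin> S"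
  then have "{u} \<in> link \<Delta> {w}" "{v} \<in> link \<Delta> {w}"
    using w by (auto simp: link_singleton_iff[OF ac] insert_commute)
  then have "(u, v) \<in> (edges_off (link \<Delta> {w}) S)\<^sup>*"
    using l uv unfolding connected_off_def by blast
  moreover have "edges_off (link \<Delta> {w}) S \<subseteq> edges_off \<Delta> S"
    using link_subset unfolding edges_off_def by fast
  ultimately show "(u, v) \<in> (edges_off \<Delta> S)\<^sup>*" using rtrancl_mono by blast
qed

lemma npm_connected:
  assumes "npm n \<Delta>" "2 \<le> n"
  shows "connected_off \<Delta> {}"
  using npmD(5)[OF assms(1) abstract_complexD(2)[OF npmD(1)[OF assms(1)]]] assms(2)
  by (simp add: link_empty)

section \<open>Dimensions zero and one\<close>

text \<open>In dimension zero the empty face is a ridge, and the facets around it are the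
  singletons.\<close>

lemma npm_1_verts:
  assumes N: "npm 1 \<Delta>"
  shows "card (complex_verts \<Delta>) = 2"
proof -
  have "bij_betw (\<lambda>v. {v}) (complex_verts \<Delta>) {F \<in> \<Delta>. {} \<subseteq> F \<and> card F = 1}"
    by (auto simp: bij_betw_def complex_verts_def image_iff card_1_singleton_iff)
  then have "card (complex_verts \<Delta>) = card {F \<in> \<Delta>. {} \<subseteq> F \<and> card F = 1}"
    by (rule bij_betw_same_card)
  also have "\<dots> = 2"
    using npmD(4)[OF N abstract_complexD(2)[OF npmD(1)[OF N]]] by simp
  finally show ?thesis .
qed

lemma in_verts_link:
  assumes "abstract_complex \<Delta>"
  shows "x \<in> complex_verts (link \<Delta> {v}) \<longleftrightarrow> x \<noteq> v \<and> {v, x} \<in> \<Delta>"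
  by (auto simp: complex_verts_def link_singleton_iff[OF assms])

text \<open>The link of \<open>v\<close> is zero-dimensional; its vertex count is the degree of
  \<open>v\<close> in the graph.\<close>

lemma npm_2_neighbours:
  assumes N: "npm 2 \<Delta>" and v: "{v} \<in> \<Delta>"
  shows "card (complex_verts (link \<Delta> {v})) = 2"
  using npm_1_verts npm_link[OF N v] by simp

text \<open>By the handshake lemma, the component of one neighbour of \<open>w\<close> in the graph without \<open>w\<close>
  cannot have exactly one vertex of odd degree, so it contains the other neighbour as well.\<close>

lemma npm_2_connected_off_vertex:
  assumes N: "npm 2 \<Delta>" and w: "{w} \<in> \<Delta>"
  shows "connected_off \<Delta> {w}"
proof (rule connected_off_reroute)
  note ac = npmD(1)[OF N]
  show "connected_off \<Delta> ({w} - {w})" using npm_connected[OF N] by simp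
  fix a b assume a: "{a, w} \<in> \<Delta>" "a \<notin> {w}" and b: "{b, w} \<in> \<Delta>" "b \<notin> {w}"
  \<comment> \<open>The component of \<open>a\<close> in the graph without \<open>w\<close>.\<close>
  define C where "C = {x. (a, x) \<in> (edges_off \<Delta> {w})\<^sup>*}"
  show "(a, b) \<in> (edges_off \<Delta> {w})\<^sup>*"
  proof (rule ccontr)
    assume "\<not> ?thesis"
    then have bC: "b \<notin> C" by (simp add: C_def)
    have aC: "a \<in> C" by (simp add: C_def)
    then have ab: "a \<noteq> b" using bC by blast
    \<comment> \<open>Since \<open>w\<close> has degree two, \<open>a\<close> and \<open>b\<close>
      are all its neighbours.\<close>
    have "{a, b} = complex_verts (link \<Delta> {w})"
    proof (rule card_subset_eq)
      show "finite (complex_verts (link \<Delta> {w}))"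
        by (rule finite_complex_verts[OF abstract_complex_link[OF ac w]])
      show "{a, b} \<subseteq> complex_verts (link \<Delta> {w})"
        using a b by (auto simp: in_verts_link[OF ac] insert_commute)
      show "card {a, b} = card (complex_verts (link \<Delta> {w}))"
        using ab npm_2_neighbours[OF N w] by simp
    qed
    then have nbw: "x = a \<or> x = b" if "{x, w} \<in> \<Delta>" "x \<noteq> w" for x
      using that in_verts_link[OF ac, of x w] by (auto simp: insert_commute)
    have CV: "{x} \<in> \<Delta> \<and> x \<noteq> w" if "x \<in> C" for x
    proof -
      have "(a, x) \<in> (edges_off \<Delta> {w})\<^sup>*" using that by (simp add: C_def)
      then show ?thesis
        by (induction rule: rtrancl_induct)
          (use a edge_verts[OF ac] in \<open>auto simp: edges_off_def\<close>)
    qed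
    have finC: "finite C"
      using finite_subset[OF _ finite_complex_verts[OF ac], of C] CV
      by (auto simp: complex_verts_def)
    have closed: "y \<in> C" if "x \<in> C" "{x, y} \<in> \<Delta>" "y \<noteq> w" for x y
    proof -
      have "(x, y) \<in> edges_off \<Delta> {w}" using that CV by (auto simp: edges_off_def)
      then show ?thesis using that(1) unfolding C_def by auto
    qed
    define E where "E = {F \<in> \<Delta>. card F = 2 \<and> F \<subseteq> C}"
    have finE: "finite E" using abstract_complexD(1)[OF ac] by (simp add: E_def)
    let ?st = "\<lambda>v. {F \<in> \<Delta>. {v} \<subseteq> F \<and> card F = 2}"
    have st2: "card (?st v) = 2" if "v \<in> C" for v
      using npmD(4)[OF N, of "{v}"] CV[OF that] by simp
    \<comment> \<open>\<open>C\<close> is closed under adjacency away from \<open>w\<close>, so an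
      edge at \<open>v\<close> leaves \<open>C\<close> only by ending in \<open>w\<close>.\<close>
    have sub: "{F \<in> E. v \<in> F} = ?st v - {{v, w}}" if v: "v \<in> C" for v
    proof (intro equalityI subsetI)
      fix F assume "F \<in> {F \<in> E. v \<in> F}"
      then show "F \<in> ?st v - {{v, w}}" using CV unfolding E_def by fastforce
    next
      fix F assume F: "F \<in> ?st v - {{v, w}}"
      then obtain y where y: "F = {v, y}" "y \<noteq> v"
        unfolding card_2_iff by auto
      then have "y \<noteq> w" using F by auto
      then have "y \<in> C" using closed v F y by auto
      then show "F \<in> {F \<in> E. v \<in> F}" using F y v unfolding E_def by auto
    qed
    have deg: "card {F \<in> E. v \<in> F} = 2" if v: "v \<in> C - {a}" for v
    proof -
      have "{v, w} \<notin> \<Delta>" using nbw[of v] v CV bC by auto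
      then have "?st v - {{v, w}} = ?st v" by blast
      then show ?thesis using sub[of v] st2[of v] v by simp
    qed
    have "{a, w} \<in> ?st a" using a by simp
    then have dega: "card {F \<in> E. a \<in> F} = 1"
      using sub[OF aC] st2[OF aC] by simp
    \<comment> \<open>Handshake count. The degree inside \<open>C\<close> is one at \<open>a\<close>
      and two elsewhere, so the sum would be odd.\<close>
    have "(\<Sum>v\<in>C. card {F \<in> E. v \<in> F}) = 2 * card E"
    proof (rule sum_multicount[OF finC finE])
      show "\<forall>F\<in>E. card {v \<in> C. v \<in> F} = 2"
      proof
        fix F assume F: "F \<in> E"
        then have "{v \<in> C. v \<in> F} = F" by (auto simp: E_def)
        then show "card {v \<in> C. v \<in> F} = 2" using F by (simp add: E_def)
      qed
    qed
    moreover have "(\<Sum>v\<in>C. card {F \<in> E. v \<in> F}) = 1 + (\<Sum>v\<in>C - {a}. 2)"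
      using sum.remove[OF finC aC, of "\<lambda>v. card {F \<in> E. v \<in> F}"] dega deg by simp
    ultimately have "2 * card E = 1 + 2 * card (C - {a})" by simp
    then show False by presburger
  qed
qed

section \<open>Banner complexes\<close>

text \<open>An \<open>npm n\<close> complex has dimension \<open>n - 1\<close>, so the critical
  cliques in the definition of \<open>banner\<close> have exactly \<open>n\<close> vertices.\<close>

lemma banner_faceI:
  assumes B: "banner \<Delta>" and N: "npm n \<Delta>"
    and cl: "\<And>u v. u \<in> T \<Longrightarrow> v \<in> T \<Longrightarrow> {u, v} \<in> \<Delta>"
    and w: "w \<in> T" "T - {w} \<in> \<Delta>" and c: "card T = n"
  shows "T \<in> \<Delta>"
proof -
  have "complex_clique \<Delta> T"
    using cl[of x x for x] cl by (auto simp: complex_clique_def complex_verts_def)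
  then have "critical_clique \<Delta> T" using w by (auto simp: critical_clique_def)
  moreover have "int (card T) = complex_dim \<Delta> + 1"
    by (simp add: c npm_complex_dim[OF N])
  ultimately show ?thesis using B unfolding banner_def spanning_clique_def by blast
qed

text \<open>Every proper subset of \<open>S\<close> misses some \<open>x\<close>, so it suffices to
  know the facets of the boundary.\<close>

lemma banner_no_boundary:
  assumes B: "banner \<Delta>" and N: "npm n \<Delta>" and c: "card S = Suc n"
    and f: "\<And>x. x \<in> S \<Longrightarrow> S - {x} \<in> \<Delta>"
  shows False
proof -
  have "finite S" using c by (metis card.infinite nat.distinct(1))
  moreover have "face_dim S = complex_dim \<Delta> + 1"
    by (simp add: face_dim_def c npm_complex_dim[OF N])
  moreover have "simplex_boundary S \<subseteq> \<Delta>"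
  proof
    fix F assume "F \<in> simplex_boundary S"
    then obtain x where "x \<in> S" "F \<subseteq> S - {x}" by (auto simp: simplex_boundary_def)
    then show "F \<in> \<Delta>" using abstract_complexD(4)[OF npmD(1)[OF N] f] by blast
  qed
  ultimately show False using B unfolding banner_def by blast
qed

text \<open>Adding \<open>v\<close> to a critical clique of the link gives a critical clique of
  \<open>\<Delta>\<close>. A simplex boundary on \<open>S\<close> in the link makes \<open>S\<close>
  itself a critical clique, hence a face, and \<open>insert v S\<close> then spans a forbidden
  boundary in \<open>\<Delta>\<close>.\<close>

lemma banner_link_vertex:
  assumes B: "banner \<Delta>" and N: "npm n \<Delta>" and n: "3 \<le> n" and v: "{v} \<in> \<Delta>"
  shows "banner (link \<Delta> {v})"
proof -
  note ac = npmD(1)[OF N]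
  have NL: "npm (n - 1) (link \<Delta> {v})" using npm_link[OF N v] by simp
  have dim: "complex_dim (link \<Delta> {v}) = int n - 2"
    using npm_complex_dim[OF NL] n by simp
  have key: "T \<in> link \<Delta> {v}"
    if cl: "\<And>x y. x \<in> T \<Longrightarrow> y \<in> T \<Longrightarrow> {x, y} \<in> link \<Delta> {v}"
      and w: "w \<in> T" "T - {w} \<in> link \<Delta> {v}" and c: "card T = n - 1" for T w
  proof -
    have vT: "v \<notin> T" using cl by (auto simp: link_singleton_iff[OF ac])
    have finT: "finite T" using c n card.infinite[of T] by (cases "finite T") auto
    have "insert v T \<in> \<Delta>"
    proof (rule banner_faceI[OF B N])
      have "{x, y} \<in> \<Delta>" if "x \<in> T" "y \<in> T" for x y
        using cl[OF that] link_subset by blast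
      moreover have "{v, x} \<in> \<Delta>" if "x \<in> T" for x
        using cl[OF that that] by (simp add: link_singleton_iff[OF ac])
      ultimately show "{x, y} \<in> \<Delta>" if "x \<in> insert v T" "y \<in> insert v T" for x y
        using that v by (metis insertE insert_absorb2 insert_commute)
      show "w \<in> insert v T" using w by simp
      have "insert v T - {w} = insert v (T - {w})" using w vT by auto
      then show "insert v T - {w} \<in> \<Delta>" using w by (simp add: link_singleton_iff[OF ac])
      show "card (insert v T) = n" using vT finT c n by simp
    qed
    then show ?thesis using vT by (simp add: link_singleton_iff[OF ac])
  qed
  show ?thesis
    unfolding banner_def
  proof (intro conjI allI impI notI)
    show "pure_complex (link \<Delta> {v})" by (rule npm_pure[OF NL])
  next
    fix T assume T: "critical_clique (link \<Delta> {v}) T \<and>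
      int (card T) = complex_dim (link \<Delta> {v}) + 1"
    then obtain w where w: "w \<in> T" "T - {w} \<in> link \<Delta> {v}"
      by (auto simp: critical_clique_def)
    have cl: "complex_clique (link \<Delta> {v}) T" using T by (simp add: critical_clique_def)
    have "T \<in> link \<Delta> {v}"
      using key[of T w] w T dim cl by (force simp: complex_clique_def)
    then show "spanning_clique (link \<Delta> {v}) T" using cl by (simp add: spanning_clique_def)
  next
    assume "\<exists>S. finite S \<and> face_dim S = complex_dim (link \<Delta> {v}) + 1 \<and>
      simplex_boundary S \<subseteq> link \<Delta> {v}"
    then obtain S where S: "finite S" "card S = n"
      and bd: "\<And>F. F \<subset> S \<Longrightarrow> F \<in> link \<Delta> {v}"
      using dim by (auto simp: face_dim_def simplex_boundary_def)
    have pair: "{x, y} \<in> link \<Delta> {v}" if "x \<in> S" "y \<in> S" for x y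
    proof -
      \<comment> \<open>Here \<open>3 \<le> n\<close> makes pairs proper subsets of
        \<open>S\<close>.\<close>
      have "card {x, y} < card S" using S n card_insert_le_m1[of 2 "{y}" x] by simp
      then show ?thesis using that by (intro bd) auto
    qed
    have vS: "v \<notin> S" using pair by (auto simp: link_singleton_iff[OF ac])
    have SD: "S \<in> \<Delta>"
    proof -
      obtain w where w: "w \<in> S" using S n by fastforce
      show ?thesis
      proof (rule banner_faceI[OF B N])
        show "{x, y} \<in> \<Delta>" if "x \<in> S" "y \<in> S" for x y
          using pair[OF that] link_subset by blast
        show "S - {w} \<in> \<Delta>" using bd[of "S - {w}"] w link_subset by blast
      qed (use w S in auto)
    qed
    show False
    proof (rule banner_no_boundary[OF B N])
      show "card (insert v S) = Suc n" using S vS by simp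
      fix x assume x: "x \<in> insert v S"
      show "insert v S - {x} \<in> \<Delta>"
      proof (cases "x = v")
        case True
        then show ?thesis using vS SD by simp
      next
        case False
        then have "insert v S - {x} = insert v (S - {x})" "S - {x} \<subset> S" using x by auto
        then show ?thesis using bd[of "S - {x}"] by (simp add: link_singleton_iff[OF ac])
      qed
    qed
  qed
qed

text \<open>The outer induction enlarges \<open>\<tau>\<close> until its link is one-dimensional;
  the inner one adds the vertices of \<open>S\<close> one at a time, rerouting around each. Both
  sets stay inside the clique \<open>T\<close>.\<close>

lemma banner_clique_connected_off:
  assumes B: "banner \<Delta>" and N: "npm n \<Delta>"
    and cl: "\<And>u v. u \<in> T \<Longrightarrow> v \<in> T \<Longrightarrow> {u, v} \<in> \<Delta>" and fin: "finite T"
    and t: "\<tau> \<in> \<Delta>" "\<tau> \<subseteq> T" "card \<tau> + 2 \<le> n" and S: "S \<subseteq> T"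
  shows "connected_off (link \<Delta> \<tau>) S"
  using t S
proof (induction "n - card \<tau>" arbitrary: \<tau> S rule: less_induct)
  case less
  note ac = npmD(1)[OF N]
  note t = less.prems(1-3)
  let ?L = "link \<Delta> \<tau>"
  have acL: "abstract_complex ?L" by (rule abstract_complex_link[OF ac t(1)])
  have NL: "npm (n - card \<tau>) ?L" by (rule npm_link[OF N t(1)])
  have "finite S" using less.prems fin finite_subset by blast
  then show ?case
    using less.prems(4)
  proof (induction S)
    case empty
    show ?case by (rule npmD(5)[OF N t(1) t(3)])
  next
    case (insert w S)
    show ?case
    proof (cases "{w} \<in> ?L")
      case False
      then have "insert w S \<inter> complex_verts ?L = S \<inter> complex_verts ?L"
        by (auto simp: complex_verts_def)
      then show ?thesis using connected_off_cong[OF acL] insert by blast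
    next
      case wL: True
      have IH: "connected_off ?L (insert w S - {w})" using insert by simp
      have wt: "\<tau> \<union> {w} \<in> \<Delta>" "w \<notin> \<tau>" using wL by (auto simp: link_def)
      have cwt: "card (\<tau> \<union> {w}) = Suc (card \<tau>)"
        using wt abstract_complexD(3)[OF ac t(1)] by simp
      have LL: "link ?L {w} = link \<Delta> (\<tau> \<union> {w})" by (rule link_link[OF ac wL])
      show ?thesis
      proof (cases "card \<tau> + 2 = n")
        case False
        \<comment> \<open>The link still has dimension at least two, so the outer hypothesis applies
          to the larger face.\<close>
        have "connected_off (link \<Delta> (\<tau> \<union> {w})) (insert w S)"
          by (rule less.hyps) (use t wt cwt insert.prems False in auto)
        then show ?thesis
          using connected_off_reroute_link[OF acL _ IH] LL by simp
      next
        case True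
        have N2: "npm 2 ?L" using NL True by (metis add_diff_cancel_left')
        show ?thesis
        proof (cases "S \<inter> complex_verts ?L = {}")
          case True
          then have "insert w S \<inter> complex_verts ?L = {w} \<inter> complex_verts ?L" by auto
          then show ?thesis
            using connected_off_cong[OF acL] npm_2_connected_off_vertex[OF N2 wL] by blast
        next
          case nonempty: False
          then obtain x where x: "x \<in> S" "{x} \<in> ?L" by (auto simp: complex_verts_def)
          have xw: "x \<noteq> w" using x insert by auto
          have xt: "\<tau> \<union> {x} \<in> \<Delta>" "x \<notin> \<tau>" using x by (auto simp: link_def)
          \<comment> \<open>A clique of \<open>n\<close> vertices inside \<open>T\<close> that
            becomes a face on dropping \<open>x\<close>: it is critical.\<close>
          have "insert x (\<tau> \<union> {w}) \<in> \<Delta>"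
          proof (rule banner_faceI[OF B N])
            show "{u, v} \<in> \<Delta>" if "u \<in> insert x (\<tau> \<union> {w})" "v \<in> insert x (\<tau> \<union> {w})" for u v
              using that t insert.prems x by (intro cl) auto
            show "insert x (\<tau> \<union> {w}) - {x} \<in> \<Delta>" using wt xt xw by simp
            show "card (insert x (\<tau> \<union> {w})) = n"
              using cwt xt xw True abstract_complexD(3)[OF ac wt(1)] by simp
          qed simp
          then have "{x, w} \<in> ?L"
            using wt xt abstract_complexD(4)[OF ac, of "insert x (\<tau> \<union> {w})" "{x, w}"]
            by (auto simp: link_def insert_commute)
          then have xV: "x \<in> complex_verts (link ?L {w})"
            using xw by (simp add: in_verts_link[OF acL] insert_commute)
          have "card (complex_verts (link ?L {w}) - {x}) = 1"
            using npm_2_neighbours[OF N2 wL] xV by simp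
          then obtain y where y: "complex_verts (link ?L {w}) - {x} = {y}"
            by (auto simp: card_1_singleton_iff)
          \<comment> \<open>Of the two neighbours of \<open>w\<close>, \<open>x\<close> is deleted;
            at most \<open>y\<close> remains, so nothing has to be joined.\<close>
          have "connected_off (link ?L {w}) (insert w S)"
            unfolding connected_off_def
          proof (intro allI impI)
            fix u v assume "{u} \<in> link ?L {w}" "{v} \<in> link ?L {w}"
              "u \<notin> insert w S" "v \<notin> insert w S"
            then have "u \<in> complex_verts (link ?L {w}) - {x}"
              "v \<in> complex_verts (link ?L {w}) - {x}"
              using x by (auto simp: complex_verts_def)
            then show "(u, v) \<in> (edges_off (link ?L {w}) (insert w S))\<^sup>*" using y by simp
          qed
          then show ?thesis using connected_off_reroute_link[OF acL _ IH] by simp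
        qed
      qed
    qed
  qed
qed

text \<open>A cone point \<open>v\<close> would make \<open>F \<union> F'\<close>, for two facets \<open>F\<close>, \<open>F'\<close> sharing the ridge
  \<open>F - {v}\<close>, the vertex set of a missing simplex.\<close>

lemma banner_non_neighbour:
  assumes B: "banner \<Delta>" and N: "npm n \<Delta>" and v: "{v} \<in> \<Delta>"
  obtains u where "{u} \<in> \<Delta>" "{v, u} \<notin> \<Delta>"
proof -
  note ac = npmD(1)[OF N]
  have False if cone: "\<And>u. {u} \<in> \<Delta> \<Longrightarrow> {v, u} \<in> \<Delta>"
  proof -
    obtain F where F: "F \<in> \<Delta>" "v \<in> F" "card F = n" using npmD(3)[OF N v] by auto
    have finF: "finite F" using abstract_complexD(3)[OF ac F(1)] .
    have "F - {v} \<in> \<Delta>" using abstract_complexD(4)[OF ac F(1)] by blast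
    moreover have "Suc (card (F - {v})) = n" using F finF card_Suc_Diff1 by metis
    ultimately have "card {G \<in> \<Delta>. F - {v} \<subseteq> G \<and> card G = n} = 2"
      by (rule npmD(4)[OF N])
    \<comment> \<open>The second facet at the ridge \<open>F - {v}\<close>; it adds a single new
      vertex \<open>u\<close>.\<close>
    then obtain G where G: "G \<in> \<Delta>" "F - {v} \<subseteq> G" "card G = n" "G \<noteq> F"
      unfolding card_2_iff by (smt (verit) insertCI mem_Collect_eq)
    have finG: "finite G" using abstract_complexD(3)[OF ac G(1)] .
    have "\<not> G \<subseteq> F" using card_subset_eq[OF finF] G F by auto
    then obtain u where u: "u \<in> G" "u \<notin> F" by blast
    have "insert u (F - {v}) = G"
    proof (rule card_subset_eq[OF finG])
      show "insert u (F - {v}) \<subseteq> G" using u G by auto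
      show "card (insert u (F - {v})) = card G"
        using u G F finF card_Suc_Diff1[OF finF F(2)] by simp
    qed
    then have GD: "insert u (F - {v}) \<in> \<Delta>" using G by simp
    have uD: "{u} \<in> \<Delta>" using abstract_complexD(4)[OF ac GD] by simp
    \<comment> \<open>Pairs containing \<open>v\<close> are edges because \<open>v\<close> is a cone
      point; all other pairs lie in \<open>G\<close>.\<close>
    have pair: "{x, y} \<in> \<Delta>" if "x \<in> insert u F" "y \<in> insert u F" for x y
    proof -
      have sg: "{z} \<in> \<Delta>" if "z \<in> insert u F" for z
        using that uD abstract_complexD(4)[OF ac F(1), of "{z}"] by auto
      show ?thesis
      proof (cases "x = v \<or> y = v")
        case True
        then show ?thesis
          using cone[OF sg[OF that(1)]] cone[OF sg[OF that(2)]] by (auto simp: insert_commute)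
      next
        case False
        then have "{x, y} \<subseteq> insert u (F - {v})" using that by auto
        then show ?thesis using abstract_complexD(4)[OF ac GD] by blast
      qed
    qed
    show False
    proof (rule banner_no_boundary[OF B N])
      show "card (insert u F) = Suc n" using u F finF by simp
      fix x assume x: "x \<in> insert u F"
      show "insert u F - {x} \<in> \<Delta>"
      proof (cases "x = u \<or> x = v")
        case True
        then show ?thesis
          using u F GD by (auto simp: insert_Diff_if)
      next
        case False
        show ?thesis
        \<comment> \<open>Removing \<open>v\<close> from this \<open>n\<close>-clique leaves a
          subset of \<open>G\<close>, so it is critical.\<close>
        proof (rule banner_faceI[OF B N])
          show "{y, z} \<in> \<Delta>" if "y \<in> insert u F - {x}" "z \<in> insert u F - {x}" for y z
            using that pair by simp
          show "v \<in> insert u F - {x}" using F False by auto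
          have "insert u F - {x} - {v} \<subseteq> insert u (F - {v})" by blast
          then show "insert u F - {x} - {v} \<in> \<Delta>" using abstract_complexD(4)[OF ac GD] by blast
          show "card (insert u F - {x}) = n" using u F finF x by simp
        qed
      qed
    qed
  qed
  then show ?thesis using that by blast
qed

section \<open>The connectivity bound\<close>

lemma npm_vertex:
  assumes "npm n \<Delta>" "1 \<le> n"
  obtains v where "{v} \<in> \<Delta>"
proof -
  note ac = npmD(1)[OF assms(1)]
  obtain G where G: "G \<in> \<Delta>" "card G = n"
    using npmD(3)[OF assms(1) abstract_complexD(2)[OF ac]] by blast
  then obtain v where "v \<in> G" using assms(2) by fastforce
  then show ?thesis using that abstract_complexD(4)[OF ac G(1), of "{v}"] by simp
qed

text \<open>Faces of a triangle boundary have at most two vertices. From dimension two on, this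
  removes the \<open>is_C3\<close> alternative from the banner condition.\<close>

lemma not_is_C3:
  assumes "npm n \<Delta>" "3 \<le> n"
  shows "\<not> is_C3 \<Delta>"
proof
  assume "is_C3 \<Delta>"
  then obtain S where S: "card S = 3" "\<Delta> = simplex_boundary S" by (auto simp: is_C3_def)
  obtain G where "G \<in> \<Delta>" "card G = n"
    using npmD(3)[OF assms(1) abstract_complexD(2)[OF npmD(1)[OF assms(1)]]] by blast
  moreover have "finite S" using S(1) by (metis card.infinite zero_neq_numeral)
  ultimately show False
    using S assms(2) psubset_card_mono[of S G] by (auto simp: simplex_boundary_def)
qed

lemma card_verts_link_less:
  assumes ac: "abstract_complex \<Delta>" and v: "{v} \<in> \<Delta>"
  shows "card (complex_verts (link \<Delta> {v})) < card (complex_verts \<Delta>)"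
proof (rule psubset_card_mono[OF finite_complex_verts[OF ac]])
  have "complex_verts (link \<Delta> {v}) \<subseteq> complex_verts \<Delta>"
    using link_subset by (auto simp: complex_verts_def)
  moreover have "v \<in> complex_verts \<Delta>" "v \<notin> complex_verts (link \<Delta> {v})"
    using v by (auto simp: in_verts_link[OF ac] complex_verts_def[of \<Delta>])
  ultimately show "complex_verts (link \<Delta> {v}) \<subset> complex_verts \<Delta>" by blast
qed

text \<open>With \<open>n = d + 1\<close>. Here \<open>j\<close> is any size at which the link
  condition holds, not the least one, so that the induction can pass to vertex links with
  \<open>j - 1\<close>.\<close>

lemma npm_connectivity:
  assumes "npm n \<Delta>" "j + 2 \<le> n"
    and "\<forall>\<sigma>\<in>\<Delta>. card \<sigma> = j \<longrightarrow> banner (link \<Delta> \<sigma>) \<or> is_C3 (link \<Delta> \<sigma>)"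
  shows "2 * (n - 1) - j < card (complex_verts \<Delta>) \<and>
    (\<forall>S. finite S \<longrightarrow> card S < 2 * (n - 1) - j \<longrightarrow> connected_off \<Delta> S)"
  using assms
proof (induction n arbitrary: \<Delta> j)
  case 0
  then show ?case by simp
next
  case (Suc n)
  note N = Suc.prems(1)
  note ac = npmD(1)[OF N]
  have conn0: "connected_off \<Delta> {}" using npm_connected[OF N] Suc.prems(2) by simp
  show ?case
  proof (cases "n = 1")
    case n1: True
    then have j0: "j = 0" and N2: "npm 2 \<Delta>"
      using Suc.prems(2) N by (auto simp: numeral_2_eq_2)
    obtain v where v: "{v} \<in> \<Delta>" using npm_vertex[OF N] by auto
    have "2 < card (complex_verts \<Delta>)"
      using card_verts_link_less[OF ac v] npm_2_neighbours[OF N2 v] by simp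
    moreover have "connected_off \<Delta> S" if S: "finite S" "card S < 2" for S
    proof -
      consider "S = {}" | w where "S = {w}"
        using S by (auto simp: less_2_cases_iff card_1_singleton_iff)
      then show ?thesis
      proof cases
        case 1
        then show ?thesis using conn0 by simp
      next
        case 2
        show ?thesis
        proof (cases "{w} \<in> \<Delta>")
          case True
          then show ?thesis using npm_2_connected_off_vertex[OF N2] 2 by simp
        next
          case False
          then have "S \<inter> complex_verts \<Delta> = {} \<inter> complex_verts \<Delta>"
            using 2 by (auto simp: complex_verts_def)
          then show ?thesis using connected_off_cong[OF ac] conn0 by blast
        qed
      qed
    qed
    ultimately show ?thesis using j0 n1 by simp
  next
    case False
    then have n2: "2 \<le> n" using Suc.prems(2) by simp
    have NL: "npm n (link \<Delta> {v})" if "{v} \<in> \<Delta>" for v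
      using npm_link[OF N that] by simp
    have B: "banner \<Delta>" if "j = 0"
    proof -
      have "banner \<Delta> \<or> is_C3 \<Delta>"
        using Suc.prems(3) abstract_complexD(2)[OF ac] that by (force simp: link_empty)
      then show ?thesis using not_is_C3[OF N] n2 by simp
    qed
    \<comment> \<open>The truncated \<open>j - 1\<close> matters: for \<open>j > 0\<close> the bound
      in the link is one less than the bound \<open>2 * n - j\<close> for \<open>\<Delta>\<close>,
      but for \<open>j = 0\<close> it is two less.\<close>
    have IH: "2 * (n - 1) - (j - 1) < card (complex_verts (link \<Delta> {v})) \<and>
      (\<forall>S. finite S \<longrightarrow> card S < 2 * (n - 1) - (j - 1) \<longrightarrow> connected_off (link \<Delta> {v}) S)"
      if v: "{v} \<in> \<Delta>" for v
    proof (rule Suc.IH[OF NL[OF v]])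
      show "j - 1 + 2 \<le> n" using n2 Suc.prems(2) by simp
      show "\<forall>\<sigma>\<in>link \<Delta> {v}. card \<sigma> = j - 1 \<longrightarrow>
        banner (link (link \<Delta> {v}) \<sigma>) \<or> is_C3 (link (link \<Delta> {v}) \<sigma>)"
      proof (intro ballI impI)
        fix \<sigma> assume s: "\<sigma> \<in> link \<Delta> {v}" "card \<sigma> = j - 1"
        have fs: "finite \<sigma>"
          using abstract_complexD(3)[OF abstract_complex_link[OF ac v] s(1)] .
        show "banner (link (link \<Delta> {v}) \<sigma>) \<or> is_C3 (link (link \<Delta> {v}) \<sigma>)"
        proof (cases "j = 0")
          case True
          then have "\<sigma> = {}" using s fs by simp
          then show ?thesis
            using banner_link_vertex[OF B[OF True] N _ v] n2 by (simp add: link_empty)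
        next
          case False
          have "insert v \<sigma> \<in> \<Delta>" "card (insert v \<sigma>) = j"
            using s fs False by (auto simp: link_singleton_iff[OF ac])
          then show ?thesis using Suc.prems(3) link_link[OF ac s(1)] by simp
        qed
      qed
    qed
    obtain v where v: "{v} \<in> \<Delta>" using npm_vertex[OF N] by auto
    have cV: "2 * n - j < card (complex_verts \<Delta>)"
    proof (cases "j = 0")
      case False
      then show ?thesis
        using IH[OF v, THEN conjunct1] card_verts_link_less[OF ac v] n2 Suc.prems(2) by linarith
    next
      case True
      \<comment> \<open>For \<open>j = 0\<close> two vertices beyond those of the link are needed:
        \<open>v\<close> and a non-neighbour of \<open>v\<close>.\<close>
      obtain u where u: "{u} \<in> \<Delta>" "{v, u} \<notin> \<Delta>"
        using banner_non_neighbour[OF B[OF True] N v] .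
      let ?V = "complex_verts (link \<Delta> {v})"
      have uv: "u \<noteq> v" using u v by auto
      have "insert u (insert v ?V) \<subseteq> complex_verts \<Delta>"
        using u v link_subset by (auto simp: complex_verts_def)
      then have "card (insert u (insert v ?V)) \<le> card (complex_verts \<Delta>)"
        by (rule card_mono[OF finite_complex_verts[OF ac]])
      moreover have "card (insert u (insert v ?V)) = Suc (Suc (card ?V))"
        using finite_complex_verts[OF abstract_complex_link[OF ac v]] u uv
        by (simp add: in_verts_link[OF ac])
      ultimately show ?thesis using IH[OF v, THEN conjunct1] True n2 by linarith
    qed
    have "connected_off \<Delta> S" if "finite S" "card S < 2 * n - j" for S
      using that
    proof (induction "card S" arbitrary: S rule: less_induct)
      case less
      have smaller: "connected_off \<Delta> (S - {w})" if "w \<in> S" for w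
        using less.hyps[of "S - {w}"] less.prems that card_Diff1_less[of S w] by simp
      show ?case
      proof (cases "\<exists>w\<in>S. {w} \<in> \<Delta> \<longrightarrow> connected_off (link \<Delta> {w}) S")
        case True
        then obtain w where w: "w \<in> S" "{w} \<in> \<Delta> \<Longrightarrow> connected_off (link \<Delta> {w}) S" by blast
        show ?thesis
        proof (cases "{w} \<in> \<Delta>")
          case True
          then show ?thesis using connected_off_reroute_link[OF ac w(1) smaller] w by blast
        next
          case False
          then have "S \<inter> complex_verts \<Delta> = (S - {w}) \<inter> complex_verts \<Delta>"
            by (auto simp: complex_verts_def)
          then show ?thesis using connected_off_cong[OF ac] smaller[OF w(1)] by blast
        qed
      next
        case bad: False
        \<comment> \<open>As \<open>S\<close> separates the link of \<open>w\<close>, it contains at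
          least \<open>2 * (n - 1) - (j - 1)\<close> of the link's vertices, while
          \<open>S - {w}\<close> has at most \<open>2 * n - j - 2\<close> elements. This forces
          \<open>j = 0\<close> and equality.\<close>
        have full: "S - {w} \<subseteq> complex_verts (link \<Delta> {w}) \<and> j = 0" if w: "w \<in> S" for w
        proof -
          let ?W = "complex_verts (link \<Delta> {w})"
          have wD: "{w} \<in> \<Delta>" and nc: "\<not> connected_off (link \<Delta> {w}) S" using bad w by auto
          have "S \<inter> ?W \<inter> ?W = S \<inter> ?W" by blast
          then have "\<not> connected_off (link \<Delta> {w}) (S \<inter> ?W)"
            using nc connected_off_cong[OF abstract_complex_link[OF ac wD]] by blast
          then have ge: "2 * (n - 1) - (j - 1) \<le> card (S \<inter> ?W)"
            using IH[OF wD] less.prems(1) by (meson finite_Int not_le)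
          have sub: "S \<inter> ?W \<subseteq> S - {w}" by (auto simp: in_verts_link[OF ac])
          have le: "card (S \<inter> ?W) \<le> card (S - {w})"
            using sub less.prems(1) by (intro card_mono) auto
          have "card (S - {w}) = card S - 1" using w less.prems(1) by simp
          then have j0: "j = 0" and eq: "card (S \<inter> ?W) = card (S - {w})"
            using ge le less.prems n2 Suc.prems(2) by linarith+
          have "S \<inter> ?W = S - {w}"
            using card_subset_eq[OF _ sub eq] less.prems(1) by simp
          then show ?thesis using j0 by blast
        qed
        show ?thesis
        proof (cases "S = {}")
          case True
          then show ?thesis using conn0 by simp
        next
          case False
          then have j0: "j = 0" using full by blast
          \<comment> \<open>\<open>S\<close> is now a clique, so the clique lemma applies with
            \<open>T = S\<close> and the empty face.\<close>
          have "connected_off (link \<Delta> {}) S"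
          proof (rule banner_clique_connected_off[OF B[OF j0] N])
            show "{x, y} \<in> \<Delta>" if "x \<in> S" "y \<in> S" for x y
              using full[OF that(1)] that bad in_verts_link[OF ac, of y x] by (cases "x = y") auto
            show "{} \<in> \<Delta>" by (rule abstract_complexD(2)[OF ac])
          qed (use less.prems n2 in auto)
          then show ?thesis by (simp add: link_empty)
        qed
      qed
    qed
    with cV show ?thesis by simp
  qed
qed

section \<open>One-dimensional complexes and the bound on the banner number\<close>

text \<open>A 2-clique is already an edge, so only a triangle can obstruct. Its vertices have degree
  two and thus no neighbours outside it, and connectedness makes it the whole complex.\<close>

lemma npm_2_banner_or_C3:
  assumes N: "npm 2 \<Delta>"
  shows "banner \<Delta> \<or> is_C3 \<Delta>"
proof (rule disjCI)
  assume nC3: "\<not> is_C3 \<Delta>"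
  note ac = npmD(1)[OF N]
  have dim: "complex_dim \<Delta> = 1" using npm_complex_dim[OF N] by simp
  show "banner \<Delta>"
    unfolding banner_def
  proof (intro conjI allI impI notI)
    show "pure_complex \<Delta>" by (rule npm_pure[OF N])
  next
    fix T assume T: "critical_clique \<Delta> T \<and> int (card T) = complex_dim \<Delta> + 1"
    then have cl: "complex_clique \<Delta> T" and "card T = 2"
      using dim by (auto simp: critical_clique_def)
    then obtain x y where "T = {x, y}" by (auto simp: card_2_iff)
    then show "spanning_clique \<Delta> T"
      using cl by (auto simp: spanning_clique_def complex_clique_def)
  next
    assume "\<exists>S. finite S \<and> face_dim S = complex_dim \<Delta> + 1 \<and> simplex_boundary S \<subseteq> \<Delta>"
    then obtain S where S: "finite S" "card S = 3" and bd: "\<And>F. F \<subset> S \<Longrightarrow> F \<in> \<Delta>"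
      using dim by (auto simp: face_dim_def simplex_boundary_def)
    have sg: "{x} \<in> \<Delta>" if "x \<in> S" for x
      using that S by (intro bd) (auto simp: psubset_eq)
    have nb: "y \<in> S" if x: "x \<in> S" and xy: "{x, y} \<in> \<Delta>" for x y
    proof (cases "y = x")
      case False
      \<comment> \<open>The other two corners already exhaust the degree of
        \<open>x\<close>.\<close>
      have "S - {x} = complex_verts (link \<Delta> {x})"
      proof (rule card_subset_eq)
        show "finite (complex_verts (link \<Delta> {x}))"
          by (rule finite_complex_verts[OF abstract_complex_link[OF ac sg[OF x]]])
        show "S - {x} \<subseteq> complex_verts (link \<Delta> {x})"
        proof
          fix z assume z: "z \<in> S - {x}"
          have "card {x, z} \<noteq> card S" using S z by auto
          then have "{x, z} \<in> \<Delta>" using x z by (intro bd) auto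
          then show "z \<in> complex_verts (link \<Delta> {x})" using z by (auto simp: in_verts_link[OF ac])
        qed
        show "card (S - {x}) = card (complex_verts (link \<Delta> {x}))"
          using npm_2_neighbours[OF N sg[OF x]] S x by simp
      qed
      then show ?thesis using xy False in_verts_link[OF ac, of y x] by blast
    qed (use x in simp)
    obtain a where a: "a \<in> S" using S by fastforce
    have VS: "x \<in> S" if "{x} \<in> \<Delta>" for x
    proof -
      have "(a, x) \<in> (edges_off \<Delta> {})\<^sup>*"
        using npm_connected[OF N] sg[OF a] that by (auto simp: connected_off_def)
      then show ?thesis
        by (induction rule: rtrancl_induct) (use a nb in \<open>auto simp: edges_off_def\<close>)
    qed
    have "\<Delta> = simplex_boundary S"
    proof (intro equalityI subsetI)
      fix F assume F: "F \<in> \<Delta>"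
      have "F \<subseteq> S" using VS abstract_complexD(4)[OF ac F] by blast
      moreover have "F \<noteq> S" using npmD(2)[OF N F] S by auto
      ultimately show "F \<in> simplex_boundary S" by (auto simp: simplex_boundary_def)
    qed (use bd in \<open>auto simp: simplex_boundary_def\<close>)
    then show False using nC3 S by (auto simp: is_C3_def)
  qed
qed

section \<open>Translation between the given definitions and \<open>connected_off\<close>,
  \<open>npm\<close>\<close>

text \<open>The graph is symmetric, so \<open>mk_symmetric\<close> adds no arcs outside
  \<open>edges_off\<close>.\<close>

lemma connected_off_if_connected:
  assumes "connected (with_proj (complex_graph \<Delta>))"
  shows "connected_off \<Delta> {}"
  unfolding connected_off_def
proof (intro allI impI)
  fix u v assume "{u} \<in> \<Delta>" "{v} \<in> \<Delta>"
  then have "(u, v) \<in> rtrancl_on (complex_verts \<Delta>)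
      (parcs (mk_symmetric (with_proj (complex_graph \<Delta>))))"
    using assms unfolding connected_def strongly_connected_def reachable_def
    by (simp add: complex_graph_def complex_verts_def)
  then have "(u, v) \<in> (parcs (mk_symmetric (with_proj (complex_graph \<Delta>))))\<^sup>*"
    by (rule rtrancl_on_rtranclI)
  moreover have "parcs (mk_symmetric (with_proj (complex_graph \<Delta>))) \<subseteq> edges_off \<Delta> {}"
    by (auto simp: parcs_mk_symmetric complex_graph_def edges_off_def insert_commute)
  ultimately show "(u, v) \<in> (edges_off \<Delta> {})\<^sup>*" using rtrancl_mono by blast
qed

lemma connected_induced_if_connected_off:
  assumes ac: "abstract_complex \<Delta>" and c: "connected_off \<Delta> S"
    and ne: "complex_verts \<Delta> - S \<noteq> {}"
  shows "connected (with_proj (complex_graph \<Delta>) \<restriction> (complex_verts \<Delta> - S))"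
proof -
  let ?V = "complex_verts \<Delta> - S"
  let ?P = "parcs (mk_symmetric (with_proj (complex_graph \<Delta>) \<restriction> ?V))"
  have "(u, v) \<in> rtrancl_on ?V ?P" if u: "u \<in> ?V" and v: "v \<in> ?V" for u v
  proof -
    have "(u, v) \<in> (edges_off \<Delta> S)\<^sup>*"
      using c u v by (auto simp: connected_off_def complex_verts_def)
    then show ?thesis
    proof (induction rule: rtrancl_induct)
      case base
      show ?case using u by simp
    next
      case (step y z)
      show ?case
      \<comment> \<open>Loops of \<open>edges_off\<close> are not arcs of the graph and are
        skipped.\<close>
      proof (cases "y = z")
        case False
        have yz: "{y, z} \<in> \<Delta>" "y \<in> ?V" "z \<in> ?V"
          using step(2) edge_verts[OF ac] by (auto simp: edges_off_def complex_verts_def)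
        then have "(y, z) \<in> ?P"
          using False by (force simp: parcs_mk_symmetric complex_graph_def)
        then show ?thesis using step(3) yz by (auto intro: rtrancl_on_into_rtrancl_on)
      qed (use step in simp)
    qed
  qed
  then show ?thesis
    using ne unfolding connected_def strongly_connected_def reachable_def by simp
qed

text \<open>Purity makes the facets exactly the faces with \<open>d + 1\<close> vertices, which
  turns conditions on dimensions into conditions on cardinalities.\<close>

lemma npm_if_normal_pseudomanifold:
  assumes P: "normal_pseudomanifold \<Delta>" and dim: "complex_dim \<Delta> = int d"
  shows "npm (Suc d) \<Delta>"
proof -
  have pure: "pure_complex \<Delta>"
    and ridge: "\<And>R. R \<in> \<Delta> \<Longrightarrow> face_dim R = int d - 1 \<Longrightarrow> card {F \<in> facets \<Delta>. R \<subseteq> F} = 2"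
    and lk: "\<And>\<tau>. \<tau> \<in> \<Delta> \<Longrightarrow> complex_dim (link \<Delta> \<tau>) \<ge> 1 \<Longrightarrow>
        connected (with_proj (complex_graph (link \<Delta> \<tau>)))"
    using P dim by (auto simp: normal_pseudomanifold_def pseudomanifold_def)
  have ac: "abstract_complex \<Delta>" using pure by (simp add: pure_complex_def)
  note fin = abstract_complexD(1)[OF ac]
  have fc: "card F = Suc d" if "F \<in> facets \<Delta>" for F
    using pure that dim by (auto simp: pure_complex_def face_dim_def)
  have ub: "card F \<le> Suc d" if "F \<in> \<Delta>" for F
  proof -
    have "face_dim F \<le> complex_dim \<Delta>"
      unfolding complex_dim_def using fin that by (intro Max_ge) auto
    then show ?thesis using dim by (simp add: face_dim_def)
  qed
  have ex: "\<exists>G\<in>\<Delta>. F \<subseteq> G \<and> card G = Suc d" if F: "F \<in> \<Delta>" for F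
  proof -
    obtain G where "G \<in> \<Delta>" "F \<subseteq> G" "\<And>H. H \<in> \<Delta> \<Longrightarrow> G \<subseteq> H \<Longrightarrow> G = H"
      using finite_has_maximal2[OF fin F] by blast
    then have "G \<in> facets \<Delta>" by (auto simp: facets_def)
    then show ?thesis using fc \<open>G \<in> \<Delta>\<close> \<open>F \<subseteq> G\<close> by blast
  qed
  have facets: "facets \<Delta> = {F \<in> \<Delta>. card F = Suc d}"
  proof (intro equalityI subsetI)
    fix F assume "F \<in> {F \<in> \<Delta>. card F = Suc d}"
    then have F: "F \<in> \<Delta>" "card F = Suc d" by auto
    have "G = F" if "G \<in> \<Delta>" "F \<subseteq> G" for G
      using card_seteq[OF abstract_complexD(3)[OF ac that(1)] that(2)] ub[OF that(1)] F by simp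
    then show "F \<in> facets \<Delta>" using F by (auto simp: facets_def)
  qed (use fc in \<open>auto simp: facets_def\<close>)
  show ?thesis
    unfolding npm_def
  proof (intro conjI ballI impI)
    fix R assume R: "R \<in> \<Delta>" "Suc (card R) = Suc d"
    have "{F \<in> \<Delta>. R \<subseteq> F \<and> card F = Suc d} = {F \<in> facets \<Delta>. R \<subseteq> F}"
      by (auto simp: facets)
    then show "card {F \<in> \<Delta>. R \<subseteq> F \<and> card F = Suc d} = 2"
      using ridge[OF R(1)] R(2) by (simp add: face_dim_def)
  next
    fix \<tau> assume t: "\<tau> \<in> \<Delta>" "card \<tau> + 2 \<le> Suc d"
    \<comment> \<open>The part of a facet outside \<open>\<tau>\<close> is a face of the link with
      at least two vertices, so the link has dimension at least one.\<close>
    obtain G where G: "G \<in> \<Delta>" "\<tau> \<subseteq> G" "card G = Suc d" using ex[OF t(1)] by blast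
    have "G - \<tau> \<union> \<tau> = G" using G by blast
    then have "G - \<tau> \<in> link \<Delta> \<tau>"
      using G abstract_complexD(4)[OF ac G(1), of "G - \<tau>"] by (auto simp: link_def)
    then have "face_dim (G - \<tau>) \<le> complex_dim (link \<Delta> \<tau>)"
      unfolding complex_dim_def
      using abstract_complexD(1)[OF abstract_complex_link[OF ac t(1)]] by (intro Max_ge) auto
    moreover have "card (G - \<tau>) = Suc d - card \<tau>"
      using G abstract_complexD(3)[OF ac t(1)] by (simp add: card_Diff_subset)
    ultimately have "complex_dim (link \<Delta> \<tau>) \<ge> 1" using t(2) by (simp add: face_dim_def)
    then show "connected_off (link \<Delta> \<tau>) {}"
      by (intro connected_off_if_connected lk t)
  qed (use ac ub ex in auto)
qed

theorem theorem1p1: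
  fixes \<Delta> :: "'a set set" and d :: nat
  assumes "d \<ge> 1"
    and "normal_pseudomanifold \<Delta>"
    and "complex_dim \<Delta> = int d"
  shows "k_connected (2 * d - banner_number \<Delta>) (complex_graph \<Delta>)"
proof -
  let ?Q = "\<lambda>j. \<forall>\<sigma>\<in>\<Delta>. card \<sigma> = j \<longrightarrow> banner (link \<Delta> \<sigma>) \<or> is_C3 (link \<Delta> \<sigma>)"
  let ?b = "banner_number \<Delta>"
  have N: "npm (Suc d) \<Delta>" by (rule npm_if_normal_pseudomanifold[OF assms(2,3)])
  note ac = npmD(1)[OF N]
  \<comment> \<open>Links of faces with \<open>d - 1\<close> vertices are one-dimensional. Hence the
    minimum exists and is at most \<open>d - 1\<close>, as \<open>j + 2 \<le> n\<close> demands for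
    \<open>n = Suc d\<close>.\<close>
  have Q: "?Q (d - 1)"
  proof (intro ballI impI)
    fix \<sigma> assume s: "\<sigma> \<in> \<Delta>" "card \<sigma> = d - 1"
    have "npm 2 (link \<Delta> \<sigma>)" using npm_link[OF N s(1)] s(2) assms(1) by (simp add: numeral_2_eq_2)
    then show "banner (link \<Delta> \<sigma>) \<or> is_C3 (link \<Delta> \<sigma>)" by (rule npm_2_banner_or_C3)
  qed
  have "?Q ?b" unfolding banner_number_def by (rule LeastI[of ?Q, OF Q])
  moreover have "?b \<le> d - 1" unfolding banner_number_def by (rule Least_le[of ?Q, OF Q])
  ultimately have main: "2 * d - ?b < card (complex_verts \<Delta>)"
    "\<And>S. finite S \<Longrightarrow> card S < 2 * d - ?b \<Longrightarrow> connected_off \<Delta> S"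
    using npm_connectivity[OF N, of ?b] assms(1) by auto
  have "connected (with_proj (complex_graph \<Delta>) \<restriction> (complex_verts \<Delta> - S))"
    if S: "S \<subseteq> complex_verts \<Delta>" "card S < 2 * d - ?b" for S
  proof (rule connected_induced_if_connected_off[OF ac])
    have "finite S" using finite_subset[OF S(1) finite_complex_verts[OF ac]] .
    then show "connected_off \<Delta> S" using main(2) S(2) by blast
    \<comment> \<open>\<open>card S\<close> is below the connectivity bound, which is below the
      number of vertices.\<close>
    show "complex_verts \<Delta> - S \<noteq> {}"
      using S main(1) by (metis Diff_eq_empty_iff less_asym' less_trans subset_antisym)
  qed
  then show ?thesis
    using main(1) unfolding k_connected_def by (simp add: complex_graph_def)
qed

end
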